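(* For all $n\ge1$, the parity-constrained Hanoi graph $P^n$ has a Hamiltonian path between the vertices $0^n$ and $3^n$.
   Context: Let $Q=\{0,1,2,3\}$ (pegs: $0,3$ neutral; $1$ reserved for even discs; $2$ reserved for odd discs). For a disc $d\in\{1,\dots,n\}$ let $p(d)=1$ if $d$ is even and $p(d)=2$ if $d$ is odd, and $Q^d=\{0,p(d),3\}$. The vertices of $P^n$ are words $s=s_n\cdots s_1\in Q^n$ ($s_d$ is the peg of disc $d$) with $s_d\in Q^d$ for all $d$. Two vertices are adjacent iff they differ in exactly one coordinate $d$, with values $i\ne j$ there, $i,j\in Q^d$, and $s_k\notin\{i,j\}$ for all $k<d$. $i^n$ denotes the word with all letters equal to $i$ (all discs on peg $i$). *)

theory Defs
  imports "HOL-Library.FuncSet" "Graph_Theory.Pair_Digraph" "Graph_Theory.Vertex_Walk"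
begin

definition pegs :: "nat set" where
  "pegs = {0, 1, 2, 3}"

definition reserved_peg :: "nat \<Rightarrow> nat" where
  "reserved_peg d = (if even d then 1 else 2)"

definition disc_pegs :: "nat \<Rightarrow> nat set" where
  "disc_pegs d = {0, reserved_peg d, 3}"

text \<open>
  A word of length \<open>n\<close> over the pegs is an extensional function on the discs \<open>{1..n}\<close>
  (disc \<open>1\<close> being the smallest), so that \<open>s d\<close> is the letter with index \<open>d\<close>.
\<close>

definition parity_states :: "nat \<Rightarrow> (nat \<Rightarrow> nat) set" where
  "parity_states n = {s \<in> {1..n} \<rightarrow>\<^sub>E pegs. \<forall>d\<in>{1..n}. s d \<in> disc_pegs d}"

definition perfect_state :: "nat \<Rightarrow> nat \<Rightarrow> nat \<Rightarrow> nat" where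
  "perfect_state n i = (\<lambda>d\<in>{1..n}. i)"

definition parity_move :: "nat \<Rightarrow> (nat \<Rightarrow> nat) \<Rightarrow> (nat \<Rightarrow> nat) \<Rightarrow> bool" where
  "parity_move n s t \<longleftrightarrow>
     (\<exists>d\<in>{1..n}. \<exists>i\<in>disc_pegs d. \<exists>j\<in>disc_pegs d.
        i \<noteq> j \<and> s d = i \<and> t d = j \<and>
        (\<forall>k\<in>{1..n}. k \<noteq> d \<longrightarrow> s k = t k) \<and>
        (\<forall>k\<in>{1..<d}. s k \<notin> {i, j}))"

text \<open>An undirected graph is a digraph with a symmetric arc set.\<close>

definition parity_hanoi_graph :: "nat \<Rightarrow> (nat \<Rightarrow> nat) pair_pre_digraph" where
  "parity_hanoi_graph n =
     \<lparr> pverts = parity_states n,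
       parcs = {(s, t). s \<in> parity_states n \<and> t \<in> parity_states n \<and> parity_move n s t} \<rparr>"

definition hamiltonian_path_between ::
  "('a, 'b) pre_digraph \<Rightarrow> 'a \<Rightarrow> 'a vwalk \<Rightarrow> 'a \<Rightarrow> bool" where
  "hamiltonian_path_between G u p v \<longleftrightarrow>
     vpath p G \<and> set p = verts G \<and> hd p = u \<and> last p = v"

lemma finite_parity_states: "finite (parity_states n)"
proof (rule finite_subset)
  show "parity_states n \<subseteq> {1..n} \<rightarrow>\<^sub>E pegs"
    by (auto simp: parity_states_def)
  show "finite ({1..n} \<rightarrow>\<^sub>E pegs)"
    by (intro finite_PiE) (auto simp: pegs_def)
qed

lemma parity_move_sym: "parity_move n s t \<Longrightarrow> parity_move n t s"
  unfolding parity_move_def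
proof (elim bexE conjE)
  fix d i j
  assume "d \<in> {1..n}" "i \<in> disc_pegs d" "j \<in> disc_pegs d" "i \<noteq> j" "s d = i" "t d = j"
    and eq: "\<forall>k\<in>{1..n}. k \<noteq> d \<longrightarrow> s k = t k"
    and less: "\<forall>k\<in>{1..<d}. s k \<notin> {i, j}"
  moreover have "\<forall>k\<in>{1..<d}. t k \<notin> {j, i}"
  proof
    fix k assume k: "k \<in> {1..<d}"
    then have "s k = t k" using eq \<open>d \<in> {1..n}\<close> by auto
    then show "t k \<notin> {j, i}" using less k by auto
  qed
  ultimately show "\<exists>d\<in>{1..n}. \<exists>i\<in>disc_pegs d. \<exists>j\<in>disc_pegs d.
        i \<noteq> j \<and> t d = i \<and> s d = j \<and>
        (\<forall>k\<in>{1..n}. k \<noteq> d \<longrightarrow> t k = s k) \<and>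
        (\<forall>k\<in>{1..<d}. t k \<notin> {i, j})"
    by (intro bexI[of _ d] bexI[of _ j] bexI[of _ i]) auto
qed

lemma pair_graph_parity_hanoi_graph: "pair_graph (parity_hanoi_graph n)"
proof
  let ?G = "parity_hanoi_graph n"
  show "finite (pverts ?G)"
    by (simp add: parity_hanoi_graph_def finite_parity_states)
  show "finite (parcs ?G)"
    by (rule finite_subset[of _ "parity_states n \<times> parity_states n"])
       (auto simp: parity_hanoi_graph_def finite_parity_states)
  show "symmetric (with_proj ?G)"
    by (auto simp: symmetric_def sym_def arcs_ends_conv parity_hanoi_graph_def
          dest: parity_move_sym)
qed (auto simp: parity_hanoi_graph_def parity_move_def)

lemma perfect_state_in_verts:
  assumes "i \<in> {0, 3}"
  shows "perfect_state n i \<in> pverts (parity_hanoi_graph n)"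
  using assms
  by (auto simp: parity_hanoi_graph_def parity_states_def perfect_state_def pegs_def disc_pegs_def)

end

theory Submission
  imports Defs
begin

text \<open>
  Disc \<open>n + 1\<close> can move between an outer peg and its reserved peg as soon as all smaller discs sit
  on the other outer peg. Hence a Hamiltonian path \<open>p\<close> of \<open>P\<^sup>n\<close> from \<open>0\<^sup>n\<close> to \<open>3\<^sup>n\<close> lifts to one of
  \<open>P\<^sup>n\<^sup>+\<^sup>1\<close>: run through \<open>p\<close> with the new disc on peg 0, through the reverse of \<open>p\<close> with the new disc
  on its reserved peg, and through \<open>p\<close> again with the new disc on peg 3.
\<close>

text \<open>Splits the vertices by the position of the largest disc. The three parts are the vertex
  sets of the three segments of the lifted path.\<close>

lemma parity_states_Suc:
  "parity_states (Suc n) = (\<Union>i\<in>disc_pegs (Suc n). (\<lambda>s. s(Suc n := i)) ` parity_states n)"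
proof (intro equalityI subsetI)
  fix s assume s: "s \<in> parity_states (Suc n)"
  define t where "t = restrict s {1..n}"
  have "t \<in> parity_states n"
    using s by (auto simp: parity_states_def t_def PiE_iff)
  moreover have "s = t(Suc n := s (Suc n))"
    using s by (auto simp: parity_states_def t_def PiE_iff extensional_def fun_eq_iff)
  moreover have "s (Suc n) \<in> disc_pegs (Suc n)"
    using s by (auto simp: parity_states_def)
  ultimately show "s \<in> (\<Union>i\<in>disc_pegs (Suc n). (\<lambda>s. s(Suc n := i)) ` parity_states n)"
    by blast
next
  have pegs: "disc_pegs d \<subseteq> pegs" for d
    by (auto simp: disc_pegs_def pegs_def reserved_peg_def)
  fix s assume "s \<in> (\<Union>i\<in>disc_pegs (Suc n). (\<lambda>s. s(Suc n := i)) ` parity_states n)"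
  then show "s \<in> parity_states (Suc n)"
    using pegs[of "Suc n"]
    by (auto simp: parity_states_def PiE_iff extensional_def)
qed

lemma inj_on_fun_upd_parity_states: "inj_on (\<lambda>s. s(Suc n := i)) (parity_states n)"
proof (rule inj_onI)
  fix s t assume *: "s \<in> parity_states n" "t \<in> parity_states n" "s(Suc n := i) = t(Suc n := i)"
  \<comment> \<open>Both values are \<open>undefined\<close>, as states are extensional on
    \<open>{1..n}\<close>; so the update overwrites no information.\<close>
  have "s (Suc n) = t (Suc n)"
    using *(1,2) by (auto simp: parity_states_def PiE_iff extensional_def)
  then show "s = t"
    using *(3) by (metis fun_upd_triv fun_upd_upd)
qed

text \<open>Only discs smaller than the moving one can block a move, and the new disc is larger than
  all others.\<close>

lemma parity_move_fun_upd:
  assumes "parity_move n s t"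
  shows "parity_move (Suc n) (s(Suc n := i)) (t(Suc n := i))"
proof -
  obtain d where d: "d \<in> {1..n}" "s d \<in> disc_pegs d" "t d \<in> disc_pegs d" "s d \<noteq> t d"
    "\<forall>k\<in>{1..n}. k \<noteq> d \<longrightarrow> s k = t k" "\<forall>k\<in>{1..<d}. s k \<notin> {s d, t d}"
    using assms unfolding parity_move_def by blast
  show ?thesis
    unfolding parity_move_def
    by (rule bexI[of _ d], rule bexI[of _ "s d"], rule bexI[of _ "t d"]) (use d in auto)
qed

lemma perfect_state_Suc: "perfect_state (Suc n) i = (perfect_state n i)(Suc n := i)"
  by (auto simp: perfect_state_def fun_eq_iff)

lemma parity_move_largest_disc:
  assumes "i \<in> disc_pegs (Suc n)" "j \<in> disc_pegs (Suc n)" "i \<noteq> j" "k \<notin> {i, j}"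
  shows "parity_move (Suc n) ((perfect_state n k)(Suc n := i)) ((perfect_state n k)(Suc n := j))"
  unfolding parity_move_def
  by (rule bexI[of _ "Suc n"], rule bexI[of _ i], rule bexI[of _ j])
    (use assms in \<open>auto simp: perfect_state_def\<close>)

text \<open>Gives access to the rules of \<open>successively\<close> for append, map and reversal,
  with which the lifted path is checked.\<close>

lemma vwalk_arcs_subset_iff: "set (vwalk_arcs p) \<subseteq> R \<longleftrightarrow> successively (\<lambda>x y. (x, y) \<in> R) p"
  by (induction p rule: vwalk_arcs.induct) auto

text \<open>Since \<open>p\<close> runs through exactly the states, the membership conditions in the
  arc set hold by themselves and only the moves remain to be checked.\<close>

lemma hamiltonian_path_between_parity_hanoi_graph_iff:
  "hamiltonian_path_between (with_proj (parity_hanoi_graph n)) u p v \<longleftrightarrow>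
     p \<noteq> [] \<and> distinct p \<and> set p = parity_states n \<and> successively (parity_move n) p \<and>
     hd p = u \<and> last p = v"
proof -
  have "arcs_ends (with_proj (parity_hanoi_graph n)) =
      {(s, t). s \<in> parity_states n \<and> t \<in> parity_states n \<and> parity_move n s t}"
    by (simp add: arcs_ends_conv parity_hanoi_graph_def)
  moreover have "successively (\<lambda>s t. s \<in> parity_states n \<and> t \<in> parity_states n \<and> parity_move n s t) p
      \<longleftrightarrow> successively (parity_move n) p" if "set p = parity_states n"
    using that by (intro successively_cong) auto
  ultimately show ?thesis
    by (cases "set p = parity_states n")
      (auto simp: hamiltonian_path_between_def vpath_def vwalk_def vwalk_arcs_subset_iff
        parity_hanoi_graph_def)
qed

lemma hamiltonian_path_Suc:
  assumes "hamiltonian_path_between (with_proj (parity_hanoi_graph n))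
             (perfect_state n 0) p (perfect_state n 3)"
  defines "f \<equiv> \<lambda>i s. s(Suc n := i)"
  shows "hamiltonian_path_between (with_proj (parity_hanoi_graph (Suc n)))
           (perfect_state (Suc n) 0)
           (map (f 0) p @ map (f (reserved_peg (Suc n))) (rev p) @ map (f 3) p)
           (perfect_state (Suc n) 3)"
proof -
  define r where "r = reserved_peg (Suc n)"
  have r: "r \<noteq> 0" "r \<noteq> 3" and disc_pegs: "disc_pegs (Suc n) = {0, r, 3}"
    by (auto simp: r_def reserved_peg_def disc_pegs_def)
  have p: "p \<noteq> []" "distinct p" "set p = parity_states n" "successively (parity_move n) p"
      "hd p = perfect_state n 0" "last p = perfect_state n 3"
    using assms(1) by (simp_all add: hamiltonian_path_between_parity_hanoi_graph_iff)
  have dist: "distinct (map (f i) p)" for i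
    using p inj_on_fun_upd_parity_states[of n i] by (simp add: distinct_map f_def)
  have f_neq: "f i s \<noteq> f j t" if "i \<noteq> j" for i j s t
    using that by (auto simp: f_def dest: fun_cong[of _ _ "Suc n"])
  have disj: "f i ` A \<inter> f j ` B = {}" if "i \<noteq> j" for i j A B
    using f_neq[OF that] by auto
  have walk: "successively (parity_move (Suc n)) (map (f i) p)" for i
    using p(4) unfolding successively_map f_def
    by (rule successively_mono) (rule parity_move_fun_upd)
  \<comment> \<open>Moves are symmetric, so a walk may be traversed backwards.\<close>
  have walk_rev: "successively (parity_move (Suc n)) (map (f i) (rev p))" for i
    using walk[of i] unfolding rev_map[symmetric] successively_rev
    by (rule successively_mono) (rule parity_move_sym)
  \<comment> \<open>The two junctions: \<open>p\<close> ends and \<open>rev p\<close> starts with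
    all smaller discs on peg 3, which leaves pegs 0 and \<open>r\<close> free; at the other end of
    \<open>rev p\<close> they are all on peg 0, which leaves \<open>r\<close> and 3 free.\<close>
  have move_0: "parity_move (Suc n) (f 0 (perfect_state n 3)) (f r (perfect_state n 3))"
    using r by (auto simp: f_def disc_pegs intro!: parity_move_largest_disc)
  have move_3: "parity_move (Suc n) (f r (perfect_state n 0)) (f 3 (perfect_state n 0))"
    using r by (auto simp: f_def disc_pegs intro!: parity_move_largest_disc)
  have "distinct (map (f 0) p @ map (f r) (rev p) @ map (f 3) p)"
    using dist r by (simp add: rev_map[symmetric] disj Int_Un_distrib)
  moreover have "set (map (f 0) p @ map (f r) (rev p) @ map (f 3) p) = parity_states (Suc n)"
    by (auto simp: parity_states_Suc disc_pegs p(3) f_def)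
  moreover have
    "successively (parity_move (Suc n)) (map (f 0) p @ map (f r) (rev p) @ map (f 3) p)"
    using p(1,5,6) walk walk_rev move_0 move_3
    by (simp add: successively_append_iff hd_map last_map hd_rev last_rev)
  moreover have "f i (perfect_state n i) = perfect_state (Suc n) i" for i
    by (simp add: f_def perfect_state_Suc)
  ultimately show ?thesis
    using p(1,5,6)
    by (simp add: hamiltonian_path_between_parity_hanoi_graph_iff r_def hd_map last_map)
qed

theorem theorem6p19:
  fixes n :: nat
  assumes "n \<ge> 1"
  shows "\<exists>p. hamiltonian_path_between (with_proj (parity_hanoi_graph n))
               (perfect_state n 0) p (perfect_state n 3)"
proof (induction n)
  case 0
  \<comment> \<open>Without discs the empty word is the only vertex, so both perfect states coincide
    and a path of one vertex suffices.\<close>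
  have "hamiltonian_path_between (with_proj (parity_hanoi_graph 0))
      (perfect_state 0 0) [perfect_state 0 0] (perfect_state 0 3)"
    by (auto simp: hamiltonian_path_between_parity_hanoi_graph_iff parity_states_def
        perfect_state_def)
  then show ?case ..
next
  case (Suc n)
  then show ?case
    using hamiltonian_path_Suc by blast
qed

end
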